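(* Let $m\ge 1$. Consider the closed-loop single-converter system described in the context, with inductance $L$, capacitance $C$, $D'=D'_n$ and inner closed-loop map $\tilde G_c=\tilde G_{c,n}$, where $$\tilde G_{c,n}(s)=\left(\frac{\tilde\omega}{s+\tilde\omega}\right)\left(\frac{s^2+2\zeta_{1,n}\omega_0 s+\omega_0^2}{s^2+2\zeta_{2,n}\omega_0 s+\omega_0^2}\right),\qquad \omega_0=2\pi\cdot 120 .$$ Consider also the closed-loop system of $m$ parallel converters described in the context, with the same outer controller $K_v$ used at every converter, with inductances $L_k$, parameters $D_k'$, gains $\gamma_k$, and inner closed-loop maps $$\tilde G_{c_k}(s)=\left(\frac{\tilde\omega}{s+\tilde\omega}\right)\left(\frac{s^2+2\zeta_1^{(k)}\omega_0 s+\omega_0^2}{s^2+2\zeta_{2,n}\omega_0 s+\omega_0^2}\right),\qquad 1\le k\le m .$$ Assume that $\sum_{k=1}^m\gamma_k D_k'\tilde G_{c_k}=D_n'\tilde G_{c,n}$, that $\sum_{k=1}^m\gamma_k=1$, and that $\gamma_k>0$ for $1\le k\le m$. Then: 1. [Performance Equivalence] Any outer-loop controller $K_v$ that stabilizes the single-converter system yields identical performance when applied to the multi-converter system. More precisely, for the same exogenous inputs, namely the reference $V_{\mathrm{des}}$, the load disturbance $d=i_{\mathrm{load}}$, and the noise $n=\sum_{k}\gamma_k n_k$, the steady-state regulated signals $\left(V_{\mathrm{des}}-V,\ \frac{D_n'}{L}\tilde u,\ V\right)$ of the single-converter system are the same as the steady-state regulated signals $\left(V_{\mathrm{des}}-V,\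 \sum_{k=1}^m\frac{D_k'}{L_k}\tilde u_k,\ V\right)$ of the multi-converter system. 2. [Power Sharing] Suppose the parameters $\gamma_k$ and $\zeta_1^{(k)}$, $1\le k\le m$, are chosen such that $$\gamma_k=\frac{\alpha_k D_n'}{D_k'}\quad\text{and}\quad \sum_{k=1}^m\alpha_k\zeta_1^{(k)}=\zeta_{1,n},$$ where $0\le\alpha_k\le 1$ and $\sum_{k=1}^m\alpha_k=1$. Then the output current at the DC-link gets divided in the ratio $\alpha_1:\alpha_2:\cdots:\alpha_m$. More precisely, the steady-state zero-frequency components $|i_1(j0)|:|i_2(j0)|:\cdots:|i_m(j0)|$ are in the same proportion as $\alpha_1:\alpha_2:\cdots:\alpha_m$. 3. [Ripple Sharing] If, in addition to the choices in part 2, the parameters $\zeta_1^{(k)}$ are chosen such that $\zeta_1^{(k)}=\frac{\beta_k\zeta_{1,n}}{\alpha_k}$, where $0\le\beta_k\le 1$ for all $k\in\{1,\dots,m\}$ and $\sum_{k=1}^m\beta_k=1$, then the design distributes the load current ripple (at 120 Hz) in the ratio $\beta_1:\beta_2:\cdots:\beta_m$. More precisely, the steady-state 120 Hz components $|i_1(j2\pi 120)|:|i_2(j2\pi 120)|:\cdots:|i_m(j2\pi 120)|$ are in the same proportion as $\beta_1:\beta_2:\cdots:\beta_m$.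
   Context: All signals are scalar and are represented by their Laplace transforms (zero initial conditions); all systems are linear, time-invariant and single-input single-output (linearized switch-cycle-averaged models of boost DC-DC converters). The number $j$ is the imaginary unit. For a signal $x$, $|x(j\omega)|$ denotes the magnitude of its steady-state component at angular frequency $\omega$, so a relation $x(s)=H(s)y(s)$ gives $|x(j\omega)|=|H(j\omega)|\,|y(j\omega)|$. A statement that $|x_1|:\cdots:|x_m|$ is in the same proportion as $a_1:\cdots:a_m$, with $\sum_k a_k=1$, means $|x_k|=a_k\sum_{l=1}^m|x_l|$ for every $k$. Parameters: $L,L_k,C>0$ are the inductances and the (DC-link) capacitance; $D'_n,D'_k>0$ are constants (complements of nominal duty cycles, e.g. $D'_k=V_{g_k}/V_{\mathrm{des}}$ with $V_{g_k}$ the source voltage of the $k$th converter; $D_n'=1-D_n$ for a nominal duty cycle $D_n$); $\tilde\omega>\omega_0=2\pi\cdot120$ rad/s; $\zeta_{1,n},\zeta_{2,n}>0$ and $\zeta_1^{(k)}$ are real damping parameters. Put $G_v(s)=\frac{1}{sC}$. Exogenous signals: $V_{\mathrm{des}}$ is the desired output voltage, $d=i_{\mathrm{load}}$ the load current (a disturbance), $n$ the voltage measurement noise. $V$ is the output (DC-link) voltage. Single-converter closed loop (inner-current, outer-voltage control). The plant is $$i_L=G_c\tilde u,\quad G_c(s)=\frac{1}{sL},\qquad V=G_v\,(D'i_L-d),$$ where $i_L$ is the inductor current and $\tilde u$ the control signal. The outer controller $K_v$ generates the current reference $i_{\mathrm{ref}}=K_v(V_{\mathrm{des}}-V-n)$.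 The inner controller $K_c$ sets $\tilde u=K_c(i_{\mathrm{ref}}-i_L)$, and $\tilde G_c=\frac{G_cK_c}{1+G_cK_c}$ denotes the resulting inner closed-loop transfer function from $i_{\mathrm{ref}}$ to $i_L$, i.e. $i_L=\tilde G_c\, i_{\mathrm{ref}}$. "$K_v$ stabilizes the single-converter system" means that this closed loop is stable. Multi-converter closed loop ($m$ converters in parallel sharing the load at the DC-link). For $1\le k\le m$ the $k$th converter has $$i_{L_k}=G_{c_k}\tilde u_k,\quad G_{c_k}(s)=\frac{1}{sL_k},\qquad i_k=D_k'\,i_{L_k},$$ where $i_{L_k}$ is its inductor current, $\tilde u_k$ its control signal and $i_k$ its output current at the DC-link, and $$V=G_v\Big(\sum_{k=1}^m i_k-d\Big).$$ The same outer controller $K_v$ is used at every converter, giving the current reference $i_{\mathrm{ref}}=K_v(V_{\mathrm{des}}-V-n)$, where $n=\sum_k\gamma_k n_k$ is the effective measurement noise and $n_k$ is the voltage measurement noise at the $k$th converter. The reference is scaled by the constant gain $\gamma_k$ in the $k$th inner loop, with inner controller $K_{c_k}$: $\tilde u_k=K_{c_k}(\gamma_k i_{\mathrm{ref}}-i_{L_k})$. With $\tilde G_{c_k}=\frac{G_{c_k}K_{c_k}}{1+G_{c_k}K_{c_k}}$ this gives $$i_{L_k}=\gamma_k\tilde G_{c_k}i_{\mathrm{ref}},\qquad i_k=\gamma_kD_k'\tilde G_{c_k}\,i_{\mathrm{ref}},\qquad \tilde u_k=sL_k\gamma_k\tilde G_{c_k}\,i_{\mathrm{ref}}.$$ The controllers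 $K_c$ and $K_{c_k}$ are chosen so that $\tilde G_c$ and $\tilde G_{c_k}$ are the transfer functions prescribed in the statement. *)

theory Defs
  imports "HOL-Complex_Analysis.Complex_Analysis"
begin

text \<open>
  Signals and transfer functions are complex functions of the Laplace variable.  A Laplace
  transform only has a meaning on some half-plane \<open>Re s > \<sigma>\<close>, so all relations between them are
  required to hold eventually along the following filter, that is, on some such half-plane.
\<close>

abbreviation far_right :: "complex filter" where
  "far_right \<equiv> filtercomap Re at_top"

text \<open>
  \<open>steady_state_component x \<omega> c\<close>: the time signal behind \<open>x\<close> has the component
  \<open>c * exp (\<i> * \<omega> * t)\<close> in steady state.  A summand \<open>c * exp (\<i> * \<omega> * t)\<close> contributes
  \<open>c / (s - \<i> * \<omega>)\<close> to the transform, and \<open>c\<close> is recovered as the limit of \<open>\<sigma> * x (\<sigma> + \<i> * \<omega>)\<close> for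
  \<open>\<sigma>\<close> tending to 0 from the right (for \<open>\<omega> = 0\<close> this is the final value theorem).  The transform is
  first continued to the open right half-plane; the continuation, hence \<open>c\<close>, is unique.
  The magnitude of the component is \<open>norm c\<close>.
\<close>

definition steady_state_component :: "(complex \<Rightarrow> complex) \<Rightarrow> real \<Rightarrow> complex \<Rightarrow> bool" where
  "steady_state_component x \<omega> c \<longleftrightarrow>
     (\<exists>F. F holomorphic_on {s. 0 < Re s} \<and>
          (\<forall>\<^sub>F s in far_right. x s = F s) \<and>
          ((\<lambda>\<sigma>. complex_of_real \<sigma> * F (Complex \<sigma> \<omega>)) \<longlongrightarrow> c) (at_right 0))"

text \<open>
  For a rational function this says: proper, with all poles in the open left half-plane.
\<close>

definition stable_tf :: "(complex \<Rightarrow> complex) \<Rightarrow> bool" where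
  "stable_tf H \<longleftrightarrow>
     (\<exists>F. F analytic_on {s. 0 \<le> Re s} \<and> bounded (F ` {s. 0 \<le> Re s}) \<and>
          (\<forall>\<^sub>F s in far_right. H s = F s))"

definition G_c :: "real \<Rightarrow> complex \<Rightarrow> complex" where
  "G_c L s = 1 / (s * complex_of_real L)"

definition G_v :: "real \<Rightarrow> complex \<Rightarrow> complex" where
  "G_v C s = 1 / (s * complex_of_real C)"

definition inner_closed_loop ::
    "(complex \<Rightarrow> complex) \<Rightarrow> (complex \<Rightarrow> complex) \<Rightarrow> complex \<Rightarrow> complex" where
  "inner_closed_loop G K s = G s * K s / (1 + G s * K s)"

definition \<omega>\<^sub>0 :: real where
  "\<omega>\<^sub>0 = 2 * pi * 120"

text \<open>
  The poles of \<open>G_inner \<omega>t \<zeta>1 \<zeta>2\<close>, where its value is 0 by the convention for division, do not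
  depend on \<open>\<zeta>1\<close>.  So an identity between linear combinations of such functions with common \<open>\<omega>t\<close>
  and \<open>\<zeta>2\<close> holds at all points iff it holds as an identity of rational functions.
\<close>

definition G_inner :: "real \<Rightarrow> real \<Rightarrow> real \<Rightarrow> complex \<Rightarrow> complex" where
  "G_inner \<omega>t \<zeta>1 \<zeta>2 s =
     (complex_of_real \<omega>t / (s + complex_of_real \<omega>t)) *
     ((s\<^sup>2 + 2 * complex_of_real \<zeta>1 * complex_of_real \<omega>\<^sub>0 * s + (complex_of_real \<omega>\<^sub>0)\<^sup>2) /
      (s\<^sup>2 + 2 * complex_of_real \<zeta>2 * complex_of_real \<omega>\<^sub>0 * s + (complex_of_real \<omega>\<^sub>0)\<^sup>2))"

definition single_loop ::
    "real \<Rightarrow> real \<Rightarrow> real \<Rightarrow> (complex \<Rightarrow> complex) \<Rightarrow> (complex \<Rightarrow> complex) \<Rightarrow>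
     (complex \<Rightarrow> complex) \<Rightarrow> (complex \<Rightarrow> complex) \<Rightarrow> (complex \<Rightarrow> complex) \<Rightarrow>
     (complex \<Rightarrow> complex) \<Rightarrow> (complex \<Rightarrow> complex) \<Rightarrow> (complex \<Rightarrow> complex) \<Rightarrow>
     (complex \<Rightarrow> complex) \<Rightarrow> bool" where
  "single_loop C L D' K\<^sub>c K\<^sub>v V\<^sub>d\<^sub>e\<^sub>s d n i\<^sub>r\<^sub>e\<^sub>f u i\<^sub>L V \<longleftrightarrow>
     (\<forall>\<^sub>F s in far_right.
        i\<^sub>r\<^sub>e\<^sub>f s = K\<^sub>v s * (V\<^sub>d\<^sub>e\<^sub>s s - V s - n s) \<and>
        u s = K\<^sub>c s * (i\<^sub>r\<^sub>e\<^sub>f s - i\<^sub>L s) \<and>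
        i\<^sub>L s = G_c L s * u s \<and>
        V s = G_v C s * (complex_of_real D' * i\<^sub>L s - d s))"

text \<open>
  The closed-loop transfer functions from one exogenous input are the responses to the unit impulse
  (with Laplace transform 1) in that input.  Requiring the responses to exist makes the loop
  well-posed, and then they are unique up to equality on a half-plane.
\<close>

definition stabilizes_single ::
    "real \<Rightarrow> real \<Rightarrow> real \<Rightarrow> (complex \<Rightarrow> complex) \<Rightarrow> (complex \<Rightarrow> complex) \<Rightarrow> bool" where
  "stabilizes_single C L D' K\<^sub>c K\<^sub>v \<longleftrightarrow>
     (\<forall>(a, b, e) \<in> {(1, 0, 0), (0, 1, 0), (0, 0, 1)}.
        \<exists>i\<^sub>r\<^sub>e\<^sub>f u i\<^sub>L V.
          single_loop C L D' K\<^sub>c K\<^sub>v (\<lambda>s. a) (\<lambda>s. b) (\<lambda>s. e) i\<^sub>r\<^sub>e\<^sub>f u i\<^sub>L V \<and>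
          stable_tf i\<^sub>r\<^sub>e\<^sub>f \<and> stable_tf u \<and> stable_tf i\<^sub>L \<and> stable_tf V)"

definition effective_noise ::
    "nat \<Rightarrow> (nat \<Rightarrow> real) \<Rightarrow> (nat \<Rightarrow> complex \<Rightarrow> complex) \<Rightarrow> complex \<Rightarrow> complex" where
  "effective_noise m \<gamma> n s = (\<Sum>k=1..m. complex_of_real (\<gamma> k) * n k s)"

definition multi_loop ::
    "nat \<Rightarrow> real \<Rightarrow> (nat \<Rightarrow> real) \<Rightarrow> (nat \<Rightarrow> real) \<Rightarrow> (nat \<Rightarrow> real) \<Rightarrow>
     (nat \<Rightarrow> complex \<Rightarrow> complex) \<Rightarrow> (complex \<Rightarrow> complex) \<Rightarrow>
     (complex \<Rightarrow> complex) \<Rightarrow> (complex \<Rightarrow> complex) \<Rightarrow> (nat \<Rightarrow> complex \<Rightarrow> complex) \<Rightarrow>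
     (complex \<Rightarrow> complex) \<Rightarrow> (nat \<Rightarrow> complex \<Rightarrow> complex) \<Rightarrow> (nat \<Rightarrow> complex \<Rightarrow> complex) \<Rightarrow>
     (nat \<Rightarrow> complex \<Rightarrow> complex) \<Rightarrow> (complex \<Rightarrow> complex) \<Rightarrow> bool" where
  "multi_loop m C L D' \<gamma> K\<^sub>c K\<^sub>v V\<^sub>d\<^sub>e\<^sub>s d n i\<^sub>r\<^sub>e\<^sub>f u i\<^sub>L i V \<longleftrightarrow>
     (\<forall>\<^sub>F s in far_right.
        i\<^sub>r\<^sub>e\<^sub>f s = K\<^sub>v s * (V\<^sub>d\<^sub>e\<^sub>s s - V s - effective_noise m \<gamma> n s) \<and>
        (\<forall>k\<in>{1..m}.
           u k s = K\<^sub>c k s * (complex_of_real (\<gamma> k) * i\<^sub>r\<^sub>e\<^sub>f s - i\<^sub>L k s) \<and>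
           i\<^sub>L k s = G_c (L k) s * u k s \<and>
           i k s = complex_of_real (D' k) * i\<^sub>L k s) \<and>
        V s = G_v C s * ((\<Sum>k=1..m. i k s) - d s))"

end

theory Submission
  imports Defs
begin

text \<open>
  Besides the plant equation \<open>i\<^sub>L = G u\<close>, an inner loop whose closed-loop map is \<open>g \<noteq> 0\<close> enforces
  \<open>i\<^sub>L = g i\<^sub>r\<^sub>e\<^sub>f\<close> and nothing more (\<open>inner_loop_iff\<close>).  The
  assumption \<open>\<Sum>\<^sub>k \<gamma>\<^sub>k D\<^sub>k' g\<^sub>k = D\<^sub>n' g\<close> then says that the \<open>m\<close> converters together inject the same
  current \<open>D\<^sub>n' g i\<^sub>r\<^sub>e\<^sub>f\<close> into the DC-link as the single one does.  Hence every solution of the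
  multi-converter loop is a solution of the single-converter loop with the same reference current
  and output voltage, and with the aggregated control \<open>\<Sum>\<^sub>k (D\<^sub>k' / L\<^sub>k) u\<^sub>k\<close> in the role of
  \<open>(D\<^sub>n' / L) u\<close> (\<open>multi_loop_imp_single_loop\<close>).

  Performance equivalence follows because a stabilized loop has only one solution
  (\<open>single_loop_unique\<close>): the existing response to a load impulse rules out that the return difference
  \<open>1 + G\<^sub>v D\<^sub>n' g K\<^sub>v\<close> vanishes.  That solution is the superposition of the three impulse responses,
  and a stable transfer function \<open>H\<close> turns a component \<open>c\<close> at frequency \<open>\<omega>\<close> into \<open>H (\<i> \<omega>) c\<close>, so the
  steady-state components of the regulated signals exist.

  For the sharing of currents, \<open>i\<^sub>k = \<gamma>\<^sub>k D\<^sub>k' g\<^sub>k i\<^sub>r\<^sub>e\<^sub>f\<close> gives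
  \<open>(\<gamma>\<^sub>l D\<^sub>l' g\<^sub>l) i\<^sub>k = (\<gamma>\<^sub>k D\<^sub>k' g\<^sub>k) i\<^sub>l\<close>, in which the possibly badly behaved \<open>i\<^sub>r\<^sub>e\<^sub>f\<close> no longer occurs.
  Passing to components at \<open>\<omega>\<close> shows that the components of the currents are proportional to
  \<open>\<gamma>\<^sub>k D\<^sub>k' g\<^sub>k (\<i> \<omega>)\<close> (\<open>current_sharing\<close>).  All \<open>g\<^sub>k\<close> equal 1 at frequency 0, which leaves the ratios \<open>\<alpha>\<^sub>k\<close>; at the notch
  frequency \<open>\<omega>\<^sub>0\<close> the quadratic factor of \<open>g\<^sub>k\<close> collapses to \<open>\<zeta>\<^sub>1\<^sub>k / \<zeta>\<^sub>2\<close>, which leaves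
  \<open>\<alpha>\<^sub>k \<zeta>\<^sub>1\<^sub>k\<close>, a multiple of \<open>\<beta>\<^sub>k\<close>.
\<close>

section \<open>Steady-state components\<close>

lemma eventually_far_right:
  "(\<forall>\<^sub>F s in far_right. P s) \<longleftrightarrow> (\<exists>N. \<forall>s. N < Re s \<longrightarrow> P s)"
  unfolding eventually_filtercomap eventually_at_top_dense by blast

lemma eventually_far_right_gt: "\<forall>\<^sub>F s in far_right. N < Re s"
  unfolding eventually_far_right by blast

lemma steady_state_component_cong:
  assumes "steady_state_component x \<omega> c" and "\<forall>\<^sub>F s in far_right. x s = y s"
  shows "steady_state_component y \<omega> c"
proof -
  have "\<forall>\<^sub>F s in far_right. y s = F s" if "\<forall>\<^sub>F s in far_right. x s = F s" for F
    using assms(2) that by eventually_elim simp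
  then show ?thesis
    using assms(1) unfolding steady_state_component_def by blast
qed

text \<open>
  Two continuations to the open right half-plane agree on some half-plane, hence everywhere by the
  identity theorem.
\<close>

lemma steady_state_component_unique:
  assumes "steady_state_component x \<omega> a" and "steady_state_component x \<omega> b"
  shows "a = b"
proof -
  obtain F where F: "F holomorphic_on {s. 0 < Re s}" "\<forall>\<^sub>F s in far_right. x s = F s"
      "((\<lambda>\<sigma>. complex_of_real \<sigma> * F (Complex \<sigma> \<omega>)) \<longlongrightarrow> a) (at_right 0)"
    using assms(1) unfolding steady_state_component_def by blast
  obtain G where G: "G holomorphic_on {s. 0 < Re s}" "\<forall>\<^sub>F s in far_right. x s = G s"
      "((\<lambda>\<sigma>. complex_of_real \<sigma> * G (Complex \<sigma> \<omega>)) \<longlongrightarrow> b) (at_right 0)"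
    using assms(2) unfolding steady_state_component_def by blast
  have "\<forall>\<^sub>F s in far_right. F s = G s"
    using F(2) G(2) by eventually_elim simp
  then obtain N where N: "\<And>s. N < Re s \<Longrightarrow> F s = G s"
    unfolding eventually_far_right by blast
  have FG: "F s = G s" if "0 < Re s" for s
  proof (rule analytic_continuation_open[of "{s. max 0 N < Re s}" "{s. 0 < Re s}" F G])
    have "complex_of_real (max 0 N + 1) \<in> {s. max 0 N < Re s}"
      by (simp add: max_def)
    then show "{s. max 0 N < Re s} \<noteq> {}"
      by blast
    show "open {s. max 0 N < Re s}"
      by (rule open_halfspace_Re_gt)
    show "connected {s. 0 < Re s}"
      by (intro convex_connected convex_halfspace_Re_gt)
  qed (use F G N that in \<open>auto intro: open_halfspace_Re_gt\<close>)
  have "\<forall>\<^sub>F \<sigma> in at_right 0.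
          complex_of_real \<sigma> * F (Complex \<sigma> \<omega>) = complex_of_real \<sigma> * G (Complex \<sigma> \<omega>)"
    using eventually_at_right_less[of "0 :: real"] by eventually_elim (simp add: FG)
  with F(3) have "((\<lambda>\<sigma>. complex_of_real \<sigma> * G (Complex \<sigma> \<omega>)) \<longlongrightarrow> a) (at_right 0)"
    by (rule Lim_transform_eventually)
  then show ?thesis
    using G(3) by (rule tendsto_unique[OF trivial_limit_at_right_real])
qed

lemma steady_state_component_add:
  assumes "steady_state_component x \<omega> a" and "steady_state_component y \<omega> b"
  shows "steady_state_component (\<lambda>s. x s + y s) \<omega> (a + b)"
proof -
  obtain F where F: "F holomorphic_on {s. 0 < Re s}" "\<forall>\<^sub>F s in far_right. x s = F s"
      "((\<lambda>\<sigma>. complex_of_real \<sigma> * F (Complex \<sigma> \<omega>)) \<longlongrightarrow> a) (at_right 0)"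
    using assms(1) unfolding steady_state_component_def by blast
  obtain G where G: "G holomorphic_on {s. 0 < Re s}" "\<forall>\<^sub>F s in far_right. y s = G s"
      "((\<lambda>\<sigma>. complex_of_real \<sigma> * G (Complex \<sigma> \<omega>)) \<longlongrightarrow> b) (at_right 0)"
    using assms(2) unfolding steady_state_component_def by blast
  have "(\<lambda>s. F s + G s) holomorphic_on {s. 0 < Re s}"
    using F(1) G(1) by (rule holomorphic_on_add)
  moreover have "\<forall>\<^sub>F s in far_right. x s + y s = F s + G s"
    using F(2) G(2) by eventually_elim simp
  moreover have "((\<lambda>\<sigma>. complex_of_real \<sigma> * (F (Complex \<sigma> \<omega>) + G (Complex \<sigma> \<omega>))) \<longlongrightarrow> a + b)
                   (at_right 0)"
    using tendsto_add[OF F(3) G(3)] by (simp add: distrib_left)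
  ultimately show ?thesis
    unfolding steady_state_component_def by (intro exI[of _ "\<lambda>s. F s + G s"] conjI)
qed

text \<open>
  This is the frequency response; analyticity at \<open>\<i> \<omega>\<close> itself makes the value there the limit of
  the values along the horizontal segment that ends there.
\<close>

lemma steady_state_component_mult_analytic:
  assumes H: "H analytic_on {s. 0 \<le> Re s}" and x: "steady_state_component x \<omega> c"
  shows "steady_state_component (\<lambda>s. H s * x s) \<omega> (H (Complex 0 \<omega>) * c)"
proof -
  obtain F where F: "F holomorphic_on {s. 0 < Re s}" "\<forall>\<^sub>F s in far_right. x s = F s"
      "((\<lambda>\<sigma>. complex_of_real \<sigma> * F (Complex \<sigma> \<omega>)) \<longlongrightarrow> c) (at_right 0)"
    using x unfolding steady_state_component_def by blast
  have "H holomorphic_on {s. 0 < Re s}"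
    by (rule holomorphic_on_subset[OF analytic_imp_holomorphic[OF H]]) auto
  then have "(\<lambda>s. H s * F s) holomorphic_on {s. 0 < Re s}"
    using F(1) by (rule holomorphic_on_mult)
  moreover have "\<forall>\<^sub>F s in far_right. H s * x s = H s * F s"
    using F(2) by eventually_elim simp
  moreover have "((\<lambda>\<sigma>. complex_of_real \<sigma> * (H (Complex \<sigma> \<omega>) * F (Complex \<sigma> \<omega>)))
                   \<longlongrightarrow> H (Complex 0 \<omega>) * c) (at_right 0)"
  proof -
    have "H analytic_on {Complex 0 \<omega>}"
      by (rule analytic_on_subset[OF H]) simp
    then have "isCont H (Complex 0 \<omega>)"
      by (rule analytic_at_imp_isCont)
    moreover have "((\<lambda>\<sigma>. Complex \<sigma> \<omega>) \<longlongrightarrow> Complex 0 \<omega>) (at_right 0)"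
      by (intro tendsto_Complex tendsto_intros)
    ultimately have "((\<lambda>\<sigma>. H (Complex \<sigma> \<omega>)) \<longlongrightarrow> H (Complex 0 \<omega>)) (at_right 0)"
      by (rule isCont_tendsto_compose)
    from tendsto_mult[OF this F(3)] show ?thesis
      by (simp add: mult_ac)
  qed
  ultimately show ?thesis
    unfolding steady_state_component_def by (intro exI[of _ "\<lambda>s. H s * F s"] conjI)
qed

lemma steady_state_component_cmult:
  assumes "steady_state_component x \<omega> c"
  shows "steady_state_component (\<lambda>s. a * x s) \<omega> (a * c)"
  using steady_state_component_mult_analytic[OF analytic_on_const assms] .

lemma steady_state_component_diff:
  assumes "steady_state_component x \<omega> a" and "steady_state_component y \<omega> b"
  shows "steady_state_component (\<lambda>s. x s - y s) \<omega> (a - b)"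
  using steady_state_component_add[OF assms(1) steady_state_component_cmult[OF assms(2), of "-1"]]
  by simp

lemma steady_state_component_stable_tf:
  assumes "stable_tf H" and "steady_state_component x \<omega> c"
  shows "\<exists>c'. steady_state_component (\<lambda>s. H s * x s) \<omega> c'"
proof -
  obtain F where F: "F analytic_on {s. 0 \<le> Re s}" "\<forall>\<^sub>F s in far_right. H s = F s"
    using assms(1) unfolding stable_tf_def by blast
  have "\<forall>\<^sub>F s in far_right. F s * x s = H s * x s"
    using F(2) by eventually_elim simp
  from steady_state_component_cong[OF steady_state_component_mult_analytic[OF F(1) assms(2)] this]
  show ?thesis ..
qed

lemma steady_state_component_superposition:
  assumes "stable_tf H\<^sub>1" and "stable_tf H\<^sub>2" and "stable_tf H\<^sub>3"
    and "\<exists>a. steady_state_component x \<omega> a" and "\<exists>a. steady_state_component y \<omega> a"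
    and "\<exists>a. steady_state_component z \<omega> a"
    and "\<forall>\<^sub>F s in far_right. H\<^sub>1 s * x s + H\<^sub>2 s * y s + H\<^sub>3 s * z s = w s"
  shows "\<exists>c. steady_state_component w \<omega> c"
proof -
  obtain a b c where
    "steady_state_component (\<lambda>s. H\<^sub>1 s * x s) \<omega> a" "steady_state_component (\<lambda>s. H\<^sub>2 s * y s) \<omega> b"
    "steady_state_component (\<lambda>s. H\<^sub>3 s * z s) \<omega> c"
    using steady_state_component_stable_tf assms(1-6) by metis
  then have "steady_state_component (\<lambda>s. H\<^sub>1 s * x s + H\<^sub>2 s * y s + H\<^sub>3 s * z s) \<omega> (a + b + c)"
    by (intro steady_state_component_add)
  from steady_state_component_cong[OF this assms(7)] show ?thesis ..
qed

section \<open>The inner loop\<close>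

text \<open>
  The hypotheses cover both uses: with \<open>a > 0\<close> there is no zero in the closed right half-plane, and
  for any real \<open>a\<close> there is none far enough to the right.
\<close>

lemma quadratic_nonzero:
  fixes a b :: real
  assumes "0 \<le> Re s" and "0 \<le> Re s + 2 * a" and "0 < Re s + a" and "b \<noteq> 0"
  shows "s\<^sup>2 + 2 * complex_of_real a * s + (complex_of_real b)\<^sup>2 \<noteq> 0"
proof
  assume *: "s\<^sup>2 + 2 * complex_of_real a * s + (complex_of_real b)\<^sup>2 = 0"
  have "2 * Im s * (Re s + a) = Im (s\<^sup>2 + 2 * complex_of_real a * s + (complex_of_real b)\<^sup>2)"
    by (simp add: power2_eq_square algebra_simps)
  then have "Im s = 0"
    using * assms(3) by auto
  have "Re s * (Re s + 2 * a) + b\<^sup>2 - (Im s)\<^sup>2 =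
          Re (s\<^sup>2 + 2 * complex_of_real a * s + (complex_of_real b)\<^sup>2)"
    by (simp add: power2_eq_square algebra_simps)
  then have "Re s * (Re s + 2 * a) + b\<^sup>2 = 0"
    using * \<open>Im s = 0\<close> by simp
  moreover have "0 < Re s * (Re s + 2 * a) + b\<^sup>2"
    using assms by (intro add_nonneg_pos mult_nonneg_nonneg) auto
  ultimately show False
    by simp
qed

lemma \<omega>\<^sub>0_pos: "0 < \<omega>\<^sub>0"
  by (simp add: \<omega>\<^sub>0_def)

lemma G_inner_denominators_nonzero:
  assumes "0 < \<omega>t" and "0 < \<zeta>2" and "0 \<le> Re s"
  shows "s + complex_of_real \<omega>t \<noteq> 0"
    and "s\<^sup>2 + 2 * complex_of_real \<zeta>2 * complex_of_real \<omega>\<^sub>0 * s + (complex_of_real \<omega>\<^sub>0)\<^sup>2 \<noteq> 0"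
proof -
  have "0 < Re (s + complex_of_real \<omega>t)"
    using assms by simp
  then show "s + complex_of_real \<omega>t \<noteq> 0"
    by force
  have "0 < \<zeta>2 * \<omega>\<^sub>0"
    using assms \<omega>\<^sub>0_pos by simp
  then show "s\<^sup>2 + 2 * complex_of_real \<zeta>2 * complex_of_real \<omega>\<^sub>0 * s + (complex_of_real \<omega>\<^sub>0)\<^sup>2 \<noteq> 0"
    using quadratic_nonzero[of s "\<zeta>2 * \<omega>\<^sub>0" "\<omega>\<^sub>0"] assms(3) \<omega>\<^sub>0_pos by (simp add: mult.assoc)
qed

lemma G_inner_analytic:
  assumes "0 < \<omega>t" and "0 < \<zeta>2"
  shows "G_inner \<omega>t \<zeta>1 \<zeta>2 analytic_on {s. 0 \<le> Re s}"
  unfolding G_inner_def[abs_def]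
  using G_inner_denominators_nonzero[OF assms] by (auto intro!: analytic_intros)

lemma G_inner_nonzero_far_right:
  assumes "0 < \<omega>t" and "0 < \<zeta>2"
  shows "\<forall>\<^sub>F s in far_right. G_inner \<omega>t \<zeta>1 \<zeta>2 s \<noteq> 0"
  using eventually_far_right_gt[of "2 * \<bar>\<zeta>1 * \<omega>\<^sub>0\<bar>"]
proof eventually_elim
  case (elim s)
  then have "s\<^sup>2 + 2 * complex_of_real (\<zeta>1 * \<omega>\<^sub>0) * s + (complex_of_real \<omega>\<^sub>0)\<^sup>2 \<noteq> 0"
    using \<omega>\<^sub>0_pos by (intro quadratic_nonzero) auto
  moreover have "0 \<le> Re s"
    using elim by linarith
  ultimately show ?case
    using G_inner_denominators_nonzero[OF assms, of s] assms
    by (simp add: G_inner_def mult.assoc)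
qed

lemma G_inner_at_0:
  assumes "\<omega>t \<noteq> 0"
  shows "G_inner \<omega>t \<zeta>1 \<zeta>2 (Complex 0 0) = 1"
  using assms \<omega>\<^sub>0_pos by (simp add: G_inner_def Complex_eq)

text \<open>
  At \<open>s = \<i> \<omega>\<^sub>0\<close> the terms \<open>s\<^sup>2\<close> and \<open>\<omega>\<^sub>0\<^sup>2\<close> of both quadratics cancel.
\<close>

lemma G_inner_at_\<omega>\<^sub>0:
  "G_inner \<omega>t \<zeta>1 \<zeta>2 (Complex 0 \<omega>\<^sub>0) =
     complex_of_real \<omega>t / (Complex 0 \<omega>\<^sub>0 + complex_of_real \<omega>t) * complex_of_real (\<zeta>1 / \<zeta>2)"
  using \<omega>\<^sub>0_pos by (simp add: G_inner_def Complex_eq power_mult_distrib)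

text \<open>
  A nonzero closed-loop value excludes \<open>1 + G K = 0\<close>, where division by zero would give the value 0.
\<close>

lemma inner_loop_iff:
  assumes "inner_closed_loop G K s = g" and "g \<noteq> 0"
  shows "u = K s * (r - i) \<and> i = G s * u \<longleftrightarrow> i = g * r \<and> i = G s * u"
proof -
  have nz: "G s * K s \<noteq> 0" "1 + G s * K s \<noteq> 0"
    using assms by (auto simp: inner_closed_loop_def)
  have "u = K s * (r - i) \<longleftrightarrow> i = g * r" if i: "i = G s * u"
  proof -
    have "u = K s * (r - i) \<longleftrightarrow> G s * u = G s * (K s * (r - i))"
      using nz(1) by simp
    also have "\<dots> \<longleftrightarrow> i * (1 + G s * K s) = G s * K s * r"
      unfolding i[symmetric] by (auto simp: algebra_simps)
    also have "\<dots> \<longleftrightarrow> i = G s * K s * r / (1 + G s * K s)"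
      using nz(2) by (simp add: eq_divide_eq)
    finally show ?thesis
      using assms(1) by (auto simp: inner_closed_loop_def)
  qed
  then show ?thesis
    by blast
qed

section \<open>The single-converter loop\<close>

lemma single_loop_superposition:
  assumes "single_loop C L D K\<^sub>c K\<^sub>v (\<lambda>s. 1) (\<lambda>s. 0) (\<lambda>s. 0) r\<^sub>1 u\<^sub>1 i\<^sub>1 V\<^sub>1"
    and "single_loop C L D K\<^sub>c K\<^sub>v (\<lambda>s. 0) (\<lambda>s. 1) (\<lambda>s. 0) r\<^sub>2 u\<^sub>2 i\<^sub>2 V\<^sub>2"
    and "single_loop C L D K\<^sub>c K\<^sub>v (\<lambda>s. 0) (\<lambda>s. 0) (\<lambda>s. 1) r\<^sub>3 u\<^sub>3 i\<^sub>3 V\<^sub>3"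
  shows "single_loop C L D K\<^sub>c K\<^sub>v x y z
           (\<lambda>s. r\<^sub>1 s * x s + r\<^sub>2 s * y s + r\<^sub>3 s * z s) (\<lambda>s. u\<^sub>1 s * x s + u\<^sub>2 s * y s + u\<^sub>3 s * z s)
           (\<lambda>s. i\<^sub>1 s * x s + i\<^sub>2 s * y s + i\<^sub>3 s * z s) (\<lambda>s. V\<^sub>1 s * x s + V\<^sub>2 s * y s + V\<^sub>3 s * z s)"
  using assms unfolding single_loop_def
proof eventually_elim
  case (elim s)
  \<comment> \<open>The four equations are circular as rewrite rules, so they are combined one kind at a time.\<close>
  have lin: "p = a \<Longrightarrow> q = b \<Longrightarrow> w = c \<Longrightarrow> e = a * x s + b * y s + c * z s
               \<Longrightarrow> p * x s + q * y s + w * z s = e" for p q w a b c e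
    by simp
  note r = lin[OF elim(1-3)[THEN conjunct1]]
    and u = lin[OF elim(1-3)[THEN conjunct2, THEN conjunct1]]
    and i = lin[OF elim(1-3)[THEN conjunct2, THEN conjunct2, THEN conjunct1]]
    and V = lin[OF elim(1-3)[THEN conjunct2, THEN conjunct2, THEN conjunct2]]
  show ?case
    by (intro conjI; (rule r u i V; simp only: algebra_simps; simp))
qed

text \<open>
  Eliminating all signals but the voltage \<open>W\<close> of a homogeneous solution leaves
  \<open>W (1 + G\<^sub>v D g K\<^sub>v) = 0\<close>, while the voltage \<open>V\<^sub>d\<close> of the load impulse response satisfies
  \<open>V\<^sub>d (1 + G\<^sub>v D g K\<^sub>v) = - G\<^sub>v \<noteq> 0\<close>.
\<close>

lemma single_loop_unique:
  assumes "C \<noteq> 0" and "L \<noteq> 0"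
    and g: "\<forall>\<^sub>F s in far_right. inner_closed_loop (G_c L) K\<^sub>c s \<noteq> 0"
    and impulse: "single_loop C L D K\<^sub>c K\<^sub>v (\<lambda>s. 0) (\<lambda>s. 1) (\<lambda>s. 0) r\<^sub>d u\<^sub>d i\<^sub>d V\<^sub>d"
    and sol1: "single_loop C L D K\<^sub>c K\<^sub>v V\<^sub>d\<^sub>e\<^sub>s d n r\<^sub>1 u\<^sub>1 i\<^sub>1 V\<^sub>1"
    and sol2: "single_loop C L D K\<^sub>c K\<^sub>v V\<^sub>d\<^sub>e\<^sub>s d n r\<^sub>2 u\<^sub>2 i\<^sub>2 V\<^sub>2"
  shows "\<forall>\<^sub>F s in far_right. r\<^sub>1 s = r\<^sub>2 s \<and> u\<^sub>1 s = u\<^sub>2 s \<and> V\<^sub>1 s = V\<^sub>2 s"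
  using g impulse[unfolded single_loop_def] sol1[unfolded single_loop_def]
    sol2[unfolded single_loop_def] eventually_far_right_gt[of 0]
proof eventually_elim
  case (elim s)
  define g where "g = inner_closed_loop (G_c L) K\<^sub>c s"
  have s: "s \<noteq> 0"
    using elim(5) by auto
  have G: "G_c L s \<noteq> 0" "G_v C s \<noteq> 0"
    using s assms(1,2) by (auto simp: G_c_def G_v_def)
  note inner = inner_loop_iff[of "G_c L" K\<^sub>c s g, THEN iffD1, THEN conjunct1]
  have i: "i\<^sub>d s = g * r\<^sub>d s" "i\<^sub>1 s = g * r\<^sub>1 s" "i\<^sub>2 s = g * r\<^sub>2 s"
    using inner elim(1-4) g_def by blast+
  define P where "P = G_v C s * D * g"
  have Vd: "V\<^sub>d s = P * r\<^sub>d s - G_v C s" "r\<^sub>d s = - (K\<^sub>v s * V\<^sub>d s)"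
    using elim(2) i by (simp_all add: P_def algebra_simps)
  have V12: "V\<^sub>1 s = P * r\<^sub>1 s - G_v C s * d s" "V\<^sub>2 s = P * r\<^sub>2 s - G_v C s * d s"
    using elim(3,4) i by (simp_all add: P_def algebra_simps)
  have r12: "r\<^sub>1 s - r\<^sub>2 s = - (K\<^sub>v s * (V\<^sub>1 s - V\<^sub>2 s))"
  proof -
    have "r\<^sub>1 s = K\<^sub>v s * (V\<^sub>d\<^sub>e\<^sub>s s - V\<^sub>1 s - n s)" "r\<^sub>2 s = K\<^sub>v s * (V\<^sub>d\<^sub>e\<^sub>s s - V\<^sub>2 s - n s)"
      using elim(3,4) by blast+
    then show ?thesis
      by (simp only:) (simp add: algebra_simps)
  qed
  have "V\<^sub>d s * (1 + P * K\<^sub>v s) = V\<^sub>d s - P * r\<^sub>d s"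
    by (simp add: Vd(2) algebra_simps)
  then have "V\<^sub>d s * (1 + P * K\<^sub>v s) = - G_v C s"
    using Vd(1) by simp
  then have "1 + P * K\<^sub>v s \<noteq> 0"
    using G by auto
  moreover have "(V\<^sub>1 s - V\<^sub>2 s) * (1 + P * K\<^sub>v s) = 0"
  proof -
    have "V\<^sub>1 s - V\<^sub>2 s = P * (r\<^sub>1 s - r\<^sub>2 s)"
      unfolding V12 by (simp add: algebra_simps)
    then show ?thesis
      unfolding r12 by (simp add: algebra_simps)
  qed
  ultimately have V: "V\<^sub>1 s = V\<^sub>2 s"
    by simp
  then have r: "r\<^sub>1 s = r\<^sub>2 s"
    using r12 by simp
  moreover have "G_c L s * u\<^sub>1 s = G_c L s * u\<^sub>2 s"
    using elim(3,4) i r by metis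
  ultimately show ?case
    using V G by simp
qed

lemma stabilized_steady_state:
  assumes "C \<noteq> 0" and "L \<noteq> 0"
    and "\<forall>\<^sub>F s in far_right. inner_closed_loop (G_c L) K\<^sub>c s \<noteq> 0"
    and stab: "stabilizes_single C L D K\<^sub>c K\<^sub>v"
    and sol: "single_loop C L D K\<^sub>c K\<^sub>v V\<^sub>d\<^sub>e\<^sub>s d n r u i V"
    and inputs: "\<exists>a. steady_state_component V\<^sub>d\<^sub>e\<^sub>s \<omega> a" "\<exists>a. steady_state_component d \<omega> a"
      "\<exists>a. steady_state_component n \<omega> a"
  shows "\<exists>c. steady_state_component r \<omega> c" and "\<exists>c. steady_state_component u \<omega> c"
    and "\<exists>c. steady_state_component V \<omega> c"
proof -
  obtain r\<^sub>1 u\<^sub>1 i\<^sub>1 V\<^sub>1 r\<^sub>2 u\<^sub>2 i\<^sub>2 V\<^sub>2 r\<^sub>3 u\<^sub>3 i\<^sub>3 V\<^sub>3 where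
    sols: "single_loop C L D K\<^sub>c K\<^sub>v (\<lambda>s. 1) (\<lambda>s. 0) (\<lambda>s. 0) r\<^sub>1 u\<^sub>1 i\<^sub>1 V\<^sub>1"
      "single_loop C L D K\<^sub>c K\<^sub>v (\<lambda>s. 0) (\<lambda>s. 1) (\<lambda>s. 0) r\<^sub>2 u\<^sub>2 i\<^sub>2 V\<^sub>2"
      "single_loop C L D K\<^sub>c K\<^sub>v (\<lambda>s. 0) (\<lambda>s. 0) (\<lambda>s. 1) r\<^sub>3 u\<^sub>3 i\<^sub>3 V\<^sub>3"
    and stable: "stable_tf r\<^sub>1" "stable_tf r\<^sub>2" "stable_tf r\<^sub>3" "stable_tf u\<^sub>1" "stable_tf u\<^sub>2"
      "stable_tf u\<^sub>3" "stable_tf V\<^sub>1" "stable_tf V\<^sub>2" "stable_tf V\<^sub>3"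
    using stab unfolding stabilizes_single_def by auto
  have eq: "\<forall>\<^sub>F s in far_right.
      r s = r\<^sub>1 s * V\<^sub>d\<^sub>e\<^sub>s s + r\<^sub>2 s * d s + r\<^sub>3 s * n s \<and>
      u s = u\<^sub>1 s * V\<^sub>d\<^sub>e\<^sub>s s + u\<^sub>2 s * d s + u\<^sub>3 s * n s \<and>
      V s = V\<^sub>1 s * V\<^sub>d\<^sub>e\<^sub>s s + V\<^sub>2 s * d s + V\<^sub>3 s * n s"
    by (rule single_loop_unique[OF assms(1-3) sols(2) sol single_loop_superposition[OF sols]])
  show "\<exists>c. steady_state_component r \<omega> c" "\<exists>c. steady_state_component u \<omega> c"
    "\<exists>c. steady_state_component V \<omega> c"
    by (rule steady_state_component_superposition[OF stable(1-3) inputs]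
        steady_state_component_superposition[OF stable(4-6) inputs]
        steady_state_component_superposition[OF stable(7-9) inputs],
        rule eventually_mono[OF eq], simp)+
qed

section \<open>Parallel converters\<close>

locale parallel_converters =
  fixes m :: nat
    and C L D \<omega>t \<zeta>1n \<zeta>2 :: real
    and L\<^sub>k D\<^sub>k \<gamma> \<zeta>1 :: "nat \<Rightarrow> real"
    and K\<^sub>c :: "complex \<Rightarrow> complex"
    and K\<^sub>c\<^sub>k :: "nat \<Rightarrow> complex \<Rightarrow> complex"
  assumes L: "L > 0" and C: "C > 0" and D: "D > 0" and \<omega>t: "\<omega>t > 0" and \<zeta>2: "\<zeta>2 > 0"
    and inner: "\<forall>\<^sub>F s in far_right. inner_closed_loop (G_c L) K\<^sub>c s = G_inner \<omega>t \<zeta>1n \<zeta>2 s"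
    and inner_k: "\<And>k. k \<in> {1..m} \<Longrightarrow>
           \<forall>\<^sub>F s in far_right.
             inner_closed_loop (G_c (L\<^sub>k k)) (K\<^sub>c\<^sub>k k) s = G_inner \<omega>t (\<zeta>1 k) \<zeta>2 s"
    and total: "\<And>s. (\<Sum>k=1..m. complex_of_real (\<gamma> k) * complex_of_real (D\<^sub>k k) *
                     G_inner \<omega>t (\<zeta>1 k) \<zeta>2 s) =
              complex_of_real D * G_inner \<omega>t \<zeta>1n \<zeta>2 s"
begin

lemma inner_nonzero: "\<forall>\<^sub>F s in far_right. inner_closed_loop (G_c L) K\<^sub>c s \<noteq> 0"
  using inner G_inner_nonzero_far_right[OF \<omega>t \<zeta>2, of \<zeta>1n] by eventually_elim simp

lemma multi_loop_currents:
  assumes "multi_loop m C L\<^sub>k D\<^sub>k \<gamma> K\<^sub>c\<^sub>k K\<^sub>v V\<^sub>d\<^sub>e\<^sub>s d n r u\<^sub>k i\<^sub>L\<^sub>k i\<^sub>k V"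
  shows "\<forall>\<^sub>F s in far_right. \<forall>k\<in>{1..m}.
           i\<^sub>k k s = complex_of_real (\<gamma> k) * complex_of_real (D\<^sub>k k) * G_inner \<omega>t (\<zeta>1 k) \<zeta>2 s * r s"
proof -
  have "\<forall>\<^sub>F s in far_right. \<forall>k\<in>{1..m}.
          inner_closed_loop (G_c (L\<^sub>k k)) (K\<^sub>c\<^sub>k k) s = G_inner \<omega>t (\<zeta>1 k) \<zeta>2 s"
    using inner_k by (intro eventually_ball_finite) auto
  moreover have "\<forall>\<^sub>F s in far_right. \<forall>k\<in>{1..m}. G_inner \<omega>t (\<zeta>1 k) \<zeta>2 s \<noteq> 0"
    using G_inner_nonzero_far_right[OF \<omega>t \<zeta>2] by (intro eventually_ball_finite) auto
  ultimately show ?thesis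
    using assms unfolding multi_loop_def
  proof eventually_elim
    case (elim s)
    show ?case
    proof
      fix k assume k: "k \<in> {1..m}"
      have "i\<^sub>L\<^sub>k k s = G_inner \<omega>t (\<zeta>1 k) \<zeta>2 s * (complex_of_real (\<gamma> k) * r s)"
        using elim k inner_loop_iff[of "G_c (L\<^sub>k k)" "K\<^sub>c\<^sub>k k" s "G_inner \<omega>t (\<zeta>1 k) \<zeta>2 s"
            "u\<^sub>k k s" "complex_of_real (\<gamma> k) * r s" "i\<^sub>L\<^sub>k k s"] by blast
      moreover have "i\<^sub>k k s = complex_of_real (D\<^sub>k k) * i\<^sub>L\<^sub>k k s"
        using elim k by blast
      ultimately show "i\<^sub>k k s = complex_of_real (\<gamma> k) * complex_of_real (D\<^sub>k k) *
                               G_inner \<omega>t (\<zeta>1 k) \<zeta>2 s * r s"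
        by simp
    qed
  qed
qed

text \<open>
  The aggregates are scaled so that \<open>D i\<^sub>L\<close> is the total current at the DC-link and \<open>(D / L) u\<close> the
  weighted sum of the controls.
\<close>

lemma multi_loop_imp_single_loop:
  assumes "multi_loop m C L\<^sub>k D\<^sub>k \<gamma> K\<^sub>c\<^sub>k K\<^sub>v V\<^sub>d\<^sub>e\<^sub>s d n r u\<^sub>k i\<^sub>L\<^sub>k i\<^sub>k V"
  shows "single_loop C L D K\<^sub>c K\<^sub>v V\<^sub>d\<^sub>e\<^sub>s d (effective_noise m \<gamma> n) r
           (\<lambda>s. complex_of_real (L / D) * (\<Sum>k=1..m. complex_of_real (D\<^sub>k k / L\<^sub>k k) * u\<^sub>k k s))
           (\<lambda>s. (\<Sum>k=1..m. i\<^sub>k k s) / complex_of_real D) V"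
  unfolding single_loop_def
  using assms[unfolded multi_loop_def] multi_loop_currents[OF assms] inner
    G_inner_nonzero_far_right[OF \<omega>t \<zeta>2, of \<zeta>1n] eventually_far_right_gt[of 0]
proof eventually_elim
  case (elim s)
  define U where "U = (\<Sum>k=1..m. complex_of_real (D\<^sub>k k / L\<^sub>k k) * u\<^sub>k k s)"
  define I where "I = (\<Sum>k=1..m. i\<^sub>k k s)"
  have s: "s \<noteq> 0"
    using elim(5) by auto
  have "I = (\<Sum>k=1..m. complex_of_real (\<gamma> k) * complex_of_real (D\<^sub>k k) *
              G_inner \<omega>t (\<zeta>1 k) \<zeta>2 s) * r s"
    unfolding I_def sum_distrib_right using elim(2) by (intro sum.cong) auto
  then have Ig: "I / complex_of_real D = G_inner \<omega>t \<zeta>1n \<zeta>2 s * r s"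
    using D total[of s] by simp
  have "I = (\<Sum>k=1..m. complex_of_real (D\<^sub>k k / L\<^sub>k k) * u\<^sub>k k s / s)"
    unfolding I_def
  proof (intro sum.cong refl)
    fix k assume k: "k \<in> {1..m}"
    have "i\<^sub>k k s = complex_of_real (D\<^sub>k k) * (G_c (L\<^sub>k k) s * u\<^sub>k k s)"
      using elim(1) k by metis
    then show "i\<^sub>k k s = complex_of_real (D\<^sub>k k / L\<^sub>k k) * u\<^sub>k k s / s"
      by (simp add: G_c_def)
  qed
  then have "I = U / s"
    by (simp add: U_def sum_divide_distrib)
  then have IU: "I / complex_of_real D = G_c L s * (complex_of_real (L / D) * U)"
    using L by (simp add: G_c_def)
  have "complex_of_real (L / D) * U = K\<^sub>c s * (r s - I / complex_of_real D)"
    using inner_loop_iff[OF elim(3,4), of "complex_of_real (L / D) * U" "r s"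
        "I / complex_of_real D"] Ig IU by blast
  moreover have "complex_of_real D * (I / complex_of_real D) = I"
    using D by simp
  ultimately show ?case
    using elim(1) IU unfolding U_def I_def by metis
qed

text \<open>
  The relation \<open>w\<^sub>l i\<^sub>k = w\<^sub>k i\<^sub>l\<close> between components is obtained without a component of \<open>r\<close>, which
  need not exist.
\<close>

lemma current_sharing:
  fixes w :: "nat \<Rightarrow> real" and \<kappa> :: complex
  assumes loop: "multi_loop m C L\<^sub>k D\<^sub>k \<gamma> K\<^sub>c\<^sub>k K\<^sub>v V\<^sub>d\<^sub>e\<^sub>s d n r u\<^sub>k i\<^sub>L\<^sub>k i\<^sub>k V"
    and w: "\<And>k. k \<in> {1..m} \<Longrightarrow> 0 \<le> w k" "(\<Sum>k=1..m. w k) = 1"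
    and gain: "\<And>k. k \<in> {1..m} \<Longrightarrow>
      complex_of_real (\<gamma> k) * complex_of_real (D\<^sub>k k) * G_inner \<omega>t (\<zeta>1 k) \<zeta>2 (Complex 0 \<omega>) =
        complex_of_real (w k) * \<kappa>"
    and "\<kappa> \<noteq> 0"
    and c: "\<And>k. k \<in> {1..m} \<Longrightarrow> steady_state_component (i\<^sub>k k) \<omega> (c k)"
    and k: "k \<in> {1..m}"
  shows "norm (c k) = w k * (\<Sum>l=1..m. norm (c l))"
proof -
  define H where
    "H k s = complex_of_real (\<gamma> k) * complex_of_real (D\<^sub>k k) * G_inner \<omega>t (\<zeta>1 k) \<zeta>2 s" for k s
  have H: "H l analytic_on {s. 0 \<le> Re s}" for l
    unfolding H_def[abs_def] by (intro analytic_intros G_inner_analytic \<omega>t \<zeta>2)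
  have cross: "w l * norm (c k) = w k * norm (c l)" if l: "l \<in> {1..m}" for l
  proof -
    have "\<forall>\<^sub>F s in far_right. H l s * i\<^sub>k k s = H k s * i\<^sub>k l s"
      using multi_loop_currents[OF loop] by eventually_elim (use k l in \<open>simp add: H_def\<close>)
    then have "H l (Complex 0 \<omega>) * c k = H k (Complex 0 \<omega>) * c l"
      by (rule steady_state_component_unique[OF
            steady_state_component_cong[OF steady_state_component_mult_analytic[OF H c[OF k]]]
            steady_state_component_mult_analytic[OF H c[OF l]]])
    then have "complex_of_real (w l) * c k = complex_of_real (w k) * c l"
      using gain k l \<open>\<kappa> \<noteq> 0\<close> by (simp add: H_def)
    then have "norm (complex_of_real (w l) * c k) = norm (complex_of_real (w k) * c l)"
      by simp
    then show ?thesis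
      using w(1) k l by (simp add: norm_mult)
  qed
  have "norm (c k) = (\<Sum>l=1..m. w l) * norm (c k)"
    using w(2) by simp
  also have "\<dots> = (\<Sum>l=1..m. w k * norm (c l))"
    unfolding sum_distrib_right by (intro sum.cong refl cross)
  finally show ?thesis
    by (simp add: sum_distrib_left)
qed

lemma stabilized_current_steady_state:
  assumes stab: "stabilizes_single C L D K\<^sub>c K\<^sub>v"
    and loop: "multi_loop m C L\<^sub>k D\<^sub>k \<gamma> K\<^sub>c\<^sub>k K\<^sub>v V\<^sub>d\<^sub>e\<^sub>s d n r u\<^sub>k i\<^sub>L\<^sub>k i\<^sub>k V"
    and inputs: "\<exists>a. steady_state_component V\<^sub>d\<^sub>e\<^sub>s \<omega> a" "\<exists>a. steady_state_component d \<omega> a"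
      "\<exists>a. steady_state_component (effective_noise m \<gamma> n) \<omega> a"
    and k: "k \<in> {1..m}"
  shows "\<exists>c. steady_state_component (i\<^sub>k k) \<omega> c"
proof -
  obtain c where c: "steady_state_component r \<omega> c"
    using stabilized_steady_state(1)[OF _ _ inner_nonzero stab multi_loop_imp_single_loop[OF loop]
        inputs] L C by auto
  define H where
    "H s = complex_of_real (\<gamma> k) * complex_of_real (D\<^sub>k k) * G_inner \<omega>t (\<zeta>1 k) \<zeta>2 s" for s
  have "H analytic_on {s. 0 \<le> Re s}"
    unfolding H_def[abs_def] by (intro analytic_intros G_inner_analytic \<omega>t \<zeta>2)
  note steady_state_component_mult_analytic[OF this c]
  moreover have "\<forall>\<^sub>F s in far_right. H s * r s = i\<^sub>k k s"
    using multi_loop_currents[OF loop] by eventually_elim (use k in \<open>simp add: H_def\<close>)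
  ultimately have "steady_state_component (i\<^sub>k k) \<omega> (H (Complex 0 \<omega>) * c)"
    by (rule steady_state_component_cong)
  then show ?thesis ..
qed

lemma performance_equivalence:
  assumes stab: "stabilizes_single C L D K\<^sub>c K\<^sub>v"
    and single: "single_loop C L D K\<^sub>c K\<^sub>v V\<^sub>d\<^sub>e\<^sub>s d (effective_noise m \<gamma> n) r u i\<^sub>L V"
    and multi: "multi_loop m C L\<^sub>k D\<^sub>k \<gamma> K\<^sub>c\<^sub>k K\<^sub>v V\<^sub>d\<^sub>e\<^sub>s d n r\<^sub>m u\<^sub>k i\<^sub>L\<^sub>k i\<^sub>k V\<^sub>m"
  shows "\<forall>\<^sub>F s in far_right.
           complex_of_real (D / L) * u s =
             (\<Sum>k=1..m. complex_of_real (D\<^sub>k k / L\<^sub>k k) * u\<^sub>k k s) \<and> V s = V\<^sub>m s"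
proof -
  obtain r\<^sub>d u\<^sub>d i\<^sub>d V\<^sub>d where
    "single_loop C L D K\<^sub>c K\<^sub>v (\<lambda>s. 0) (\<lambda>s. 1) (\<lambda>s. 0) r\<^sub>d u\<^sub>d i\<^sub>d V\<^sub>d"
    using bspec[OF stab[unfolded stabilizes_single_def], of "(0, 1, 0)"] by auto
  from single_loop_unique[OF _ _ inner_nonzero this single multi_loop_imp_single_loop[OF multi]]
  have "\<forall>\<^sub>F s in far_right.
      u s = complex_of_real (L / D) * (\<Sum>k=1..m. complex_of_real (D\<^sub>k k / L\<^sub>k k) * u\<^sub>k k s) \<and>
      V s = V\<^sub>m s"
    using L C by (auto elim: eventually_mono)
  then show ?thesis
    by eventually_elim (use L D in simp)
qed

end

section \<open>Performance equivalence, power sharing and ripple sharing\<close>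

theorem theorem1:
  fixes m :: nat
    and C L D\<^sub>n' \<omega>t \<zeta>1n \<zeta>2n :: real
    and L\<^sub>k D\<^sub>k' \<gamma> \<zeta>1 :: "nat \<Rightarrow> real"
    and K\<^sub>c K\<^sub>v :: "complex \<Rightarrow> complex"
    and K\<^sub>c\<^sub>k :: "nat \<Rightarrow> complex \<Rightarrow> complex"
  assumes "m \<ge> 1"
    and "L > 0" and "C > 0" and "D\<^sub>n' > 0" and "\<omega>t > \<omega>\<^sub>0" and "\<zeta>1n > 0" and "\<zeta>2n > 0"
    and "\<And>k. k \<in> {1..m} \<Longrightarrow> L\<^sub>k k > 0"
    and "\<And>k. k \<in> {1..m} \<Longrightarrow> D\<^sub>k' k > 0"
    and "\<forall>\<^sub>F s in far_right. inner_closed_loop (G_c L) K\<^sub>c s = G_inner \<omega>t \<zeta>1n \<zeta>2n s"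
    and "\<And>k. k \<in> {1..m} \<Longrightarrow>
           \<forall>\<^sub>F s in far_right.
             inner_closed_loop (G_c (L\<^sub>k k)) (K\<^sub>c\<^sub>k k) s = G_inner \<omega>t (\<zeta>1 k) \<zeta>2n s"
    and "\<And>s. (\<Sum>k=1..m. complex_of_real (\<gamma> k) * complex_of_real (D\<^sub>k' k) *
                     G_inner \<omega>t (\<zeta>1 k) \<zeta>2n s) =
              complex_of_real D\<^sub>n' * G_inner \<omega>t \<zeta>1n \<zeta>2n s"
    and "(\<Sum>k=1..m. \<gamma> k) = 1"
    and "\<And>k. k \<in> {1..m} \<Longrightarrow> \<gamma> k > 0"
  shows
      "(stabilizes_single C L D\<^sub>n' K\<^sub>c K\<^sub>v \<longrightarrow>
       (\<forall>V\<^sub>d\<^sub>e\<^sub>s d n i\<^sub>r\<^sub>e\<^sub>f u i\<^sub>L V i\<^sub>r\<^sub>e\<^sub>f\<^sub>m u\<^sub>k i\<^sub>L\<^sub>k i\<^sub>k V\<^sub>m.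
          single_loop C L D\<^sub>n' K\<^sub>c K\<^sub>v V\<^sub>d\<^sub>e\<^sub>s d (effective_noise m \<gamma> n) i\<^sub>r\<^sub>e\<^sub>f u i\<^sub>L V \<and>
          multi_loop m C L\<^sub>k D\<^sub>k' \<gamma> K\<^sub>c\<^sub>k K\<^sub>v V\<^sub>d\<^sub>e\<^sub>s d n i\<^sub>r\<^sub>e\<^sub>f\<^sub>m u\<^sub>k i\<^sub>L\<^sub>k i\<^sub>k V\<^sub>m \<longrightarrow>
          (\<forall>\<^sub>F s in far_right.
             V\<^sub>d\<^sub>e\<^sub>s s - V s = V\<^sub>d\<^sub>e\<^sub>s s - V\<^sub>m s \<and>
             complex_of_real (D\<^sub>n' / L) * u s =
               (\<Sum>k=1..m. complex_of_real (D\<^sub>k' k / L\<^sub>k k) * u\<^sub>k k s) \<and>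
             V s = V\<^sub>m s) \<and>
          (\<forall>\<omega>. (\<exists>a. steady_state_component V\<^sub>d\<^sub>e\<^sub>s \<omega> a) \<and>
               (\<exists>a. steady_state_component d \<omega> a) \<and>
               (\<exists>a. steady_state_component (effective_noise m \<gamma> n) \<omega> a) \<longrightarrow>
             (\<exists>c. steady_state_component (\<lambda>s. V\<^sub>d\<^sub>e\<^sub>s s - V s) \<omega> c \<and>
                  steady_state_component (\<lambda>s. V\<^sub>d\<^sub>e\<^sub>s s - V\<^sub>m s) \<omega> c) \<and>
             (\<exists>c. steady_state_component (\<lambda>s. complex_of_real (D\<^sub>n' / L) * u s) \<omega> c \<and>
                  steady_state_component
                    (\<lambda>s. \<Sum>k=1..m. complex_of_real (D\<^sub>k' k / L\<^sub>k k) * u\<^sub>k k s) \<omega> c) \<and>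
             (\<exists>c. steady_state_component V \<omega> c \<and> steady_state_component V\<^sub>m \<omega> c)))) \<and>
       (\<forall>\<alpha>.
         (\<forall>k\<in>{1..m}. \<gamma> k = \<alpha> k * D\<^sub>n' / D\<^sub>k' k \<and> 0 \<le> \<alpha> k \<and> \<alpha> k \<le> 1) \<and>
         (\<Sum>k=1..m. \<alpha> k * \<zeta>1 k) = \<zeta>1n \<and> (\<Sum>k=1..m. \<alpha> k) = 1 \<longrightarrow>
         (\<forall>V\<^sub>d\<^sub>e\<^sub>s d n i\<^sub>r\<^sub>e\<^sub>f u\<^sub>k i\<^sub>L\<^sub>k i\<^sub>k V.
            multi_loop m C L\<^sub>k D\<^sub>k' \<gamma> K\<^sub>c\<^sub>k K\<^sub>v V\<^sub>d\<^sub>e\<^sub>s d n i\<^sub>r\<^sub>e\<^sub>f u\<^sub>k i\<^sub>L\<^sub>k i\<^sub>k V \<longrightarrow>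
            (stabilizes_single C L D\<^sub>n' K\<^sub>c K\<^sub>v \<and>
             (\<exists>a. steady_state_component V\<^sub>d\<^sub>e\<^sub>s 0 a) \<and>
             (\<exists>a. steady_state_component d 0 a) \<and>
             (\<exists>a. steady_state_component (effective_noise m \<gamma> n) 0 a) \<longrightarrow>
               (\<forall>k\<in>{1..m}. \<exists>c. steady_state_component (i\<^sub>k k) 0 c)) \<and>
            (\<forall>c. (\<forall>k\<in>{1..m}. steady_state_component (i\<^sub>k k) 0 (c k)) \<longrightarrow>
               (\<forall>k\<in>{1..m}. norm (c k) = \<alpha> k * (\<Sum>l=1..m. norm (c l)))))) \<and>
       (\<forall>\<alpha> \<beta>.
         (\<forall>k\<in>{1..m}. \<gamma> k = \<alpha> k * D\<^sub>n' / D\<^sub>k' k \<and> 0 \<le> \<alpha> k \<and> \<alpha> k \<le> 1) \<and>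
         (\<Sum>k=1..m. \<alpha> k * \<zeta>1 k) = \<zeta>1n \<and> (\<Sum>k=1..m. \<alpha> k) = 1 \<and>
         (\<forall>k\<in>{1..m}. \<zeta>1 k = \<beta> k * \<zeta>1n / \<alpha> k \<and> 0 \<le> \<beta> k \<and> \<beta> k \<le> 1) \<and>
         (\<Sum>k=1..m. \<beta> k) = 1 \<longrightarrow>
         (\<forall>V\<^sub>d\<^sub>e\<^sub>s d n i\<^sub>r\<^sub>e\<^sub>f u\<^sub>k i\<^sub>L\<^sub>k i\<^sub>k V.
            multi_loop m C L\<^sub>k D\<^sub>k' \<gamma> K\<^sub>c\<^sub>k K\<^sub>v V\<^sub>d\<^sub>e\<^sub>s d n i\<^sub>r\<^sub>e\<^sub>f u\<^sub>k i\<^sub>L\<^sub>k i\<^sub>k V \<longrightarrow>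
            (stabilizes_single C L D\<^sub>n' K\<^sub>c K\<^sub>v \<and>
             (\<exists>a. steady_state_component V\<^sub>d\<^sub>e\<^sub>s (2 * pi * 120) a) \<and>
             (\<exists>a. steady_state_component d (2 * pi * 120) a) \<and>
             (\<exists>a. steady_state_component (effective_noise m \<gamma> n) (2 * pi * 120) a) \<longrightarrow>
               (\<forall>k\<in>{1..m}. \<exists>c. steady_state_component (i\<^sub>k k) (2 * pi * 120) c)) \<and>
            (\<forall>c. (\<forall>k\<in>{1..m}. steady_state_component (i\<^sub>k k) (2 * pi * 120) (c k)) \<longrightarrow>
               (\<forall>k\<in>{1..m}. norm (c k) = \<beta> k * (\<Sum>l=1..m. norm (c l))))))"
proof (intro conjI allI impI)
  interpret parallel_converters m C L D\<^sub>n' \<omega>t \<zeta>1n \<zeta>2n L\<^sub>k D\<^sub>k' \<gamma> \<zeta>1 K\<^sub>c K\<^sub>c\<^sub>k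
    using assms \<omega>\<^sub>0_pos by unfold_locales auto
  {
    fix V\<^sub>d\<^sub>e\<^sub>s d n i\<^sub>r\<^sub>e\<^sub>f u i\<^sub>L V i\<^sub>r\<^sub>e\<^sub>f\<^sub>m u\<^sub>k i\<^sub>L\<^sub>k i\<^sub>k V\<^sub>m
    assume stab: "stabilizes_single C L D\<^sub>n' K\<^sub>c K\<^sub>v"
      and loops:
        "single_loop C L D\<^sub>n' K\<^sub>c K\<^sub>v V\<^sub>d\<^sub>e\<^sub>s d (effective_noise m \<gamma> n) i\<^sub>r\<^sub>e\<^sub>f u i\<^sub>L V \<and>
         multi_loop m C L\<^sub>k D\<^sub>k' \<gamma> K\<^sub>c\<^sub>k K\<^sub>v V\<^sub>d\<^sub>e\<^sub>s d n i\<^sub>r\<^sub>e\<^sub>f\<^sub>m u\<^sub>k i\<^sub>L\<^sub>k i\<^sub>k V\<^sub>m"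
    note eq = performance_equivalence[OF stab conjunct1[OF loops] conjunct2[OF loops]]
    show eq': "\<forall>\<^sub>F s in far_right.
           V\<^sub>d\<^sub>e\<^sub>s s - V s = V\<^sub>d\<^sub>e\<^sub>s s - V\<^sub>m s \<and>
           complex_of_real (D\<^sub>n' / L) * u s =
             (\<Sum>k=1..m. complex_of_real (D\<^sub>k' k / L\<^sub>k k) * u\<^sub>k k s) \<and>
           V s = V\<^sub>m s"
      using eq by eventually_elim simp
    fix \<omega>
    assume inputs: "(\<exists>a. steady_state_component V\<^sub>d\<^sub>e\<^sub>s \<omega> a) \<and>
                    (\<exists>a. steady_state_component d \<omega> a) \<and>
                    (\<exists>a. steady_state_component (effective_noise m \<gamma> n) \<omega> a)"
    note steady = stabilized_steady_state[OF _ _ inner_nonzero stab conjunct1[OF loops],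
        of \<omega>]
    obtain a b c where abc: "steady_state_component V\<^sub>d\<^sub>e\<^sub>s \<omega> a" "steady_state_component u \<omega> b"
        "steady_state_component V \<omega> c"
      using steady inputs L C by auto
    have err: "steady_state_component (\<lambda>s. V\<^sub>d\<^sub>e\<^sub>s s - V s) \<omega> (a - c)"
      using abc by (intro steady_state_component_diff)
    have "\<forall>\<^sub>F s in far_right. V\<^sub>d\<^sub>e\<^sub>s s - V s = V\<^sub>d\<^sub>e\<^sub>s s - V\<^sub>m s"
      using eq by eventually_elim simp
    from err steady_state_component_cong[OF err this]
    show "\<exists>c. steady_state_component (\<lambda>s. V\<^sub>d\<^sub>e\<^sub>s s - V s) \<omega> c \<and>
                steady_state_component (\<lambda>s. V\<^sub>d\<^sub>e\<^sub>s s - V\<^sub>m s) \<omega> c"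
      by blast
    have ctrl: "steady_state_component (\<lambda>s. complex_of_real (D\<^sub>n' / L) * u s) \<omega>
            (complex_of_real (D\<^sub>n' / L) * b)"
      using abc by (intro steady_state_component_cmult)
    have "\<forall>\<^sub>F s in far_right. complex_of_real (D\<^sub>n' / L) * u s =
                     (\<Sum>k=1..m. complex_of_real (D\<^sub>k' k / L\<^sub>k k) * u\<^sub>k k s)"
      using eq by (rule eventually_mono) blast
    from ctrl steady_state_component_cong[OF ctrl this]
    show "\<exists>c. steady_state_component (\<lambda>s. complex_of_real (D\<^sub>n' / L) * u s) \<omega> c \<and>
                steady_state_component
                  (\<lambda>s. \<Sum>k=1..m. complex_of_real (D\<^sub>k' k / L\<^sub>k k) * u\<^sub>k k s) \<omega> c"
      by blast
    have "\<forall>\<^sub>F s in far_right. V s = V\<^sub>m s"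
      using eq by (rule eventually_mono) blast
    from abc(3) steady_state_component_cong[OF abc(3) this]
    show "\<exists>c. steady_state_component V \<omega> c \<and> steady_state_component V\<^sub>m \<omega> c"
      by blast
  }
  {
    fix \<alpha> V\<^sub>d\<^sub>e\<^sub>s d n i\<^sub>r\<^sub>e\<^sub>f u\<^sub>k i\<^sub>L\<^sub>k i\<^sub>k V
    assume \<alpha>: "(\<forall>k\<in>{1..m}. \<gamma> k = \<alpha> k * D\<^sub>n' / D\<^sub>k' k \<and> 0 \<le> \<alpha> k \<and> \<alpha> k \<le> 1) \<and>
         (\<Sum>k=1..m. \<alpha> k * \<zeta>1 k) = \<zeta>1n \<and> (\<Sum>k=1..m. \<alpha> k) = 1"
      and loop: "multi_loop m C L\<^sub>k D\<^sub>k' \<gamma> K\<^sub>c\<^sub>k K\<^sub>v V\<^sub>d\<^sub>e\<^sub>s d n i\<^sub>r\<^sub>e\<^sub>f u\<^sub>k i\<^sub>L\<^sub>k i\<^sub>k V"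
    show "\<forall>k\<in>{1..m}. \<exists>c. steady_state_component (i\<^sub>k k) 0 c"
      if "stabilizes_single C L D\<^sub>n' K\<^sub>c K\<^sub>v \<and>
             (\<exists>a. steady_state_component V\<^sub>d\<^sub>e\<^sub>s 0 a) \<and>
             (\<exists>a. steady_state_component d 0 a) \<and>
             (\<exists>a. steady_state_component (effective_noise m \<gamma> n) 0 a)"
      using that stabilized_current_steady_state[OF _ loop] by blast
    fix c
    assume c: "\<forall>k\<in>{1..m}. steady_state_component (i\<^sub>k k) 0 (c k)"
    have "complex_of_real (\<gamma> k) * complex_of_real (D\<^sub>k' k) *
            G_inner \<omega>t (\<zeta>1 k) \<zeta>2n (Complex 0 0) = complex_of_real (\<alpha> k) * complex_of_real D\<^sub>n'"
      if "k \<in> {1..m}" for k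
    proof -
      have "\<gamma> k * D\<^sub>k' k = \<alpha> k * D\<^sub>n'"
        using \<alpha> assms(9)[OF that] that by simp
      then have "complex_of_real (\<gamma> k) * complex_of_real (D\<^sub>k' k) =
                   complex_of_real (\<alpha> k) * complex_of_real D\<^sub>n'"
        by (simp flip: of_real_mult)
      then show ?thesis
        using \<omega>t by (simp add: G_inner_at_0)
    qed
    then show "\<forall>k\<in>{1..m}. norm (c k) = \<alpha> k * (\<Sum>l=1..m. norm (c l))"
      using current_sharing[OF loop, of \<alpha> 0 "complex_of_real D\<^sub>n'" c] \<alpha> c D by auto
  }
  {
    fix \<alpha> \<beta> V\<^sub>d\<^sub>e\<^sub>s d n i\<^sub>r\<^sub>e\<^sub>f u\<^sub>k i\<^sub>L\<^sub>k i\<^sub>k V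
    assume \<alpha>\<beta>: "(\<forall>k\<in>{1..m}. \<gamma> k = \<alpha> k * D\<^sub>n' / D\<^sub>k' k \<and> 0 \<le> \<alpha> k \<and> \<alpha> k \<le> 1) \<and>
         (\<Sum>k=1..m. \<alpha> k * \<zeta>1 k) = \<zeta>1n \<and> (\<Sum>k=1..m. \<alpha> k) = 1 \<and>
         (\<forall>k\<in>{1..m}. \<zeta>1 k = \<beta> k * \<zeta>1n / \<alpha> k \<and> 0 \<le> \<beta> k \<and> \<beta> k \<le> 1) \<and>
         (\<Sum>k=1..m. \<beta> k) = 1"
      and loop: "multi_loop m C L\<^sub>k D\<^sub>k' \<gamma> K\<^sub>c\<^sub>k K\<^sub>v V\<^sub>d\<^sub>e\<^sub>s d n i\<^sub>r\<^sub>e\<^sub>f u\<^sub>k i\<^sub>L\<^sub>k i\<^sub>k V"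
    show "\<forall>k\<in>{1..m}. \<exists>c. steady_state_component (i\<^sub>k k) (2 * pi * 120) c"
      if "stabilizes_single C L D\<^sub>n' K\<^sub>c K\<^sub>v \<and>
             (\<exists>a. steady_state_component V\<^sub>d\<^sub>e\<^sub>s (2 * pi * 120) a) \<and>
             (\<exists>a. steady_state_component d (2 * pi * 120) a) \<and>
             (\<exists>a. steady_state_component (effective_noise m \<gamma> n) (2 * pi * 120) a)"
      using that stabilized_current_steady_state[OF _ loop] by blast
    fix c
    assume "\<forall>k\<in>{1..m}. steady_state_component (i\<^sub>k k) (2 * pi * 120) (c k)"
    then have c: "\<And>k. k \<in> {1..m} \<Longrightarrow> steady_state_component (i\<^sub>k k) \<omega>\<^sub>0 (c k)"
      by (simp add: \<omega>\<^sub>0_def)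
    define \<kappa> where "\<kappa> = complex_of_real (D\<^sub>n' * \<zeta>1n / \<zeta>2n) *
                        (complex_of_real \<omega>t / (Complex 0 \<omega>\<^sub>0 + complex_of_real \<omega>t))"
    have "\<kappa> \<noteq> 0"
      using G_inner_denominators_nonzero(1)[OF \<omega>t \<zeta>2, of "Complex 0 \<omega>\<^sub>0"] \<omega>t \<zeta>2 D assms(6)
      by (simp add: \<kappa>_def)
    moreover have "complex_of_real (\<gamma> k) * complex_of_real (D\<^sub>k' k) *
            G_inner \<omega>t (\<zeta>1 k) \<zeta>2n (Complex 0 \<omega>\<^sub>0) = complex_of_real (\<beta> k) * \<kappa>"
      if k: "k \<in> {1..m}" for k
    proof -
      \<comment> \<open>Positivity of the gain makes the division by \<open>\<alpha> k\<close> in the choice of \<open>\<zeta>1 k\<close> genuine.\<close>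
      have "\<alpha> k \<noteq> 0"
        using \<alpha>\<beta> assms(14)[OF k] k by auto
      moreover have "\<zeta>1 k = \<beta> k * \<zeta>1n / \<alpha> k" "\<gamma> k = \<alpha> k * D\<^sub>n' / D\<^sub>k' k"
        using \<alpha>\<beta> k by blast+
      ultimately have "\<gamma> k * D\<^sub>k' k * (\<zeta>1 k / \<zeta>2n) = \<beta> k * (D\<^sub>n' * \<zeta>1n / \<zeta>2n)"
        using assms(9)[OF k] by simp
      then have "complex_of_real (\<gamma> k) * complex_of_real (D\<^sub>k' k) * complex_of_real (\<zeta>1 k / \<zeta>2n) =
                   complex_of_real (\<beta> k) * complex_of_real (D\<^sub>n' * \<zeta>1n / \<zeta>2n)"
        unfolding of_real_mult[symmetric] by (simp only:)
      then have "complex_of_real (\<gamma> k) * complex_of_real (D\<^sub>k' k) *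
                     (x * complex_of_real (\<zeta>1 k / \<zeta>2n)) =
                   complex_of_real (\<beta> k) * (complex_of_real (D\<^sub>n' * \<zeta>1n / \<zeta>2n) * x)" for x
        by (metis mult.assoc mult.commute)
      then show ?thesis
        unfolding G_inner_at_\<omega>\<^sub>0 \<kappa>_def .
    qed
    ultimately show "\<forall>k\<in>{1..m}. norm (c k) = \<beta> k * (\<Sum>l=1..m. norm (c l))"
      using current_sharing[OF loop, of \<beta> \<omega>\<^sub>0 \<kappa> c] \<alpha>\<beta> c by auto
  }
qed

end
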